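(* Suppose $X=\{x_1,x_2,x_3\}$ is a three point set in $\mathbb{CH}^n=\mathbb{B}^n$ and $H=DA_n(X)$. The points of $X$ lie on a geodesic if and only if $LF_{123}=\delta_{13}$ and $A_{123}=0$.
   Context: $\mathbb{B}^n\subset\mathbb{C}^n$ is the open unit ball, the model of complex hyperbolic space $\mathbb{CH}^n$, with the pseudohyperbolic metric $\rho$ given by $1-\rho(z,w)^2=\frac{(1-|z|^2)(1-|w|^2)}{|1-\langle z,w\rangle|^2}$ and the Riemannian (Bergman-Poincaré) metric that is the length metric generated by $\rho$; geodesics are those of the latter metric (the geodesics are the images of $\{(x,0,\dots,0):x\in(-1,1)\}$ under biholomorphic automorphisms of $\mathbb{B}^n$). $DA_n$ is the Hilbert space of holomorphic functions on $\mathbb{B}^n$ with reproducing kernels $k_z(w)=(1-\langle w,z\rangle)^{-1}$, and $DA_n(X)$ is the span of $\{k_x\}_{x\in X}$. Write $k_{ij}=\langle k_{x_i},k_{x_j}\rangle=k_{x_i}(x_j)$. Then $\delta_{ij}=\left(1-\frac{|k_{ij}|^2}{k_{ii}k_{jj}}\right)^{1/2}$, $A_{123}=\arg(k_{12}k_{23}k_{31})$ with $|\arg|\le\pi$, and $LF_{123}\ge0$ is defined by $LF_{123}^2=\frac1{\delta_{12}^2}\left|1-\frac{k_{21}k_{13}}{k_{23}k_{11}}\right|^2$. *)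

theory Defs
  imports "HOL-Analysis.Analysis"
begin

definition hprod :: "complex ^ 'n \<Rightarrow> complex ^ 'n \<Rightarrow> complex" where
  "hprod z w = (\<Sum>i\<in>UNIV. z $ i * cnj (w $ i))"

definition rho :: "complex ^ 'n \<Rightarrow> complex ^ 'n \<Rightarrow> real" where
  "rho z w = sqrt (1 - (1 - (norm z)\<^sup>2) * (1 - (norm w)\<^sup>2) / (cmod (1 - hprod z w))\<^sup>2)"

(* Length of a path with respect to rho: supremum of the polygonal sums over all
   partitions t_0 <= ... <= t_m of the parameter interval [0,1]. *)
definition rho_length :: "(real \<Rightarrow> complex ^ 'n) \<Rightarrow> ereal" where
  "rho_length g =
     (SUP ts\<in>{ts. sorted ts \<and> set ts \<subseteq> {0..1}}.
        ereal (\<Sum>i<length ts - 1. rho (g (ts ! i)) (g (ts ! Suc i))))"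

(* The Bergman-Poincare distance on the unit ball is the length metric generated by rho. *)
definition bergman_dist :: "complex ^ 'n \<Rightarrow> complex ^ 'n \<Rightarrow> ereal" where
  "bergman_dist z w =
     (INF g\<in>{g. path g \<and> path_image g \<subseteq> ball 0 1 \<and> pathstart g = z \<and> pathfinish g = w}.
        rho_length g)"

(* Complete geodesics as point sets: isometrically embedded copies of the real line. *)
definition is_geodesic :: "(complex ^ 'n) set \<Rightarrow> bool" where
  "is_geodesic L \<longleftrightarrow>
     (\<exists>c :: real \<Rightarrow> complex ^ 'n.
        range c \<subseteq> ball 0 1 \<and>
        (\<forall>s t. bergman_dist (c s) (c t) = ereal \<bar>s - t\<bar>) \<and>
        L = range c)"

definition holomorphic_on_ball :: "(complex ^ 'n \<Rightarrow> complex) \<Rightarrow> bool" where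
  "holomorphic_on_ball f \<longleftrightarrow>
     (\<forall>z\<in>ball 0 1. \<exists>D. (f has_derivative D) (at z) \<and> (\<forall>c v. D (c *s v) = c * D v))"

(* Functions on the open unit ball are represented by total functions that vanish
   outside the ball, so that equality of functions is equality on the ball. *)
definition da_kernel :: "complex ^ 'n \<Rightarrow> complex ^ 'n \<Rightarrow> complex" where
  "da_kernel z w = (if w \<in> ball 0 1 then inverse (1 - hprod w z) else 0)"

(* H with inner product ip (linear in the first argument) is the Hilbert space of
   holomorphic functions on the unit ball with reproducing kernels da_kernel z.
   A Hilbert function space is determined by its reproducing kernels, so there is
   exactly one such H, and ip is unique on H. *)
locale drury_arveson =
  fixes H :: "(complex ^ 'n \<Rightarrow> complex) set"
    and ip :: "(complex ^ 'n \<Rightarrow> complex) \<Rightarrow> (complex ^ 'n \<Rightarrow> complex) \<Rightarrow> complex"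
  assumes holomorphic: "f \<in> H \<Longrightarrow> holomorphic_on_ball f"
    and outside: "f \<in> H \<Longrightarrow> z \<notin> ball 0 1 \<Longrightarrow> f z = 0"
    and zero_mem: "(\<lambda>_. 0) \<in> H"
    and add_mem: "f \<in> H \<Longrightarrow> g \<in> H \<Longrightarrow> (\<lambda>z. f z + g z) \<in> H"
    and scale_mem: "f \<in> H \<Longrightarrow> (\<lambda>z. c * f z) \<in> H"
    and ip_add: "f \<in> H \<Longrightarrow> g \<in> H \<Longrightarrow> h \<in> H \<Longrightarrow> ip (\<lambda>z. f z + g z) h = ip f h + ip g h"
    and ip_scale: "f \<in> H \<Longrightarrow> h \<in> H \<Longrightarrow> ip (\<lambda>z. c * f z) h = c * ip f h"
    and ip_cnj: "f \<in> H \<Longrightarrow> g \<in> H \<Longrightarrow> ip g f = cnj (ip f g)"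
    and ip_pos: "f \<in> H \<Longrightarrow> f \<noteq> (\<lambda>_. 0) \<Longrightarrow> 0 < Re (ip f f)"
    and complete:
      "(\<And>i. F i \<in> H) \<Longrightarrow>
       (\<And>e. e > 0 \<Longrightarrow> \<exists>N::nat. \<forall>i\<ge>N. \<forall>j\<ge>N.
          sqrt (Re (ip (\<lambda>z. F i z - F j z) (\<lambda>z. F i z - F j z))) < e) \<Longrightarrow>
       \<exists>f\<in>H. (\<lambda>i. sqrt (Re (ip (\<lambda>z. F i z - f z) (\<lambda>z. F i z - f z)))) \<longlonglongrightarrow> 0"
    and kernel_mem: "x \<in> ball 0 1 \<Longrightarrow> da_kernel x \<in> H"
    and reproducing: "x \<in> ball 0 1 \<Longrightarrow> f \<in> H \<Longrightarrow> f x = ip f (da_kernel x)"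

(* DA_n(X), the span of the kernel functions at the points of X. *)
definition da_span :: "(complex ^ 'n) set \<Rightarrow> (complex ^ 'n \<Rightarrow> complex) set" where
  "da_span X = {f. \<exists>S c. finite S \<and> S \<subseteq> X \<and> f = (\<lambda>w. \<Sum>x\<in>S. c x * da_kernel x w)}"

(* Invariants of vectors u, v, w (in the order 1, 2, 3) with Gram matrix
   k11 = ip u u, k12 = ip u v, ...; the diagonal entries are real. *)
definition delta :: "('v \<Rightarrow> 'v \<Rightarrow> complex) \<Rightarrow> 'v \<Rightarrow> 'v \<Rightarrow> real" where
  "delta ip u v = sqrt (1 - (cmod (ip u v))\<^sup>2 / (Re (ip u u) * Re (ip v v)))"

definition angular_invariant :: "('v \<Rightarrow> 'v \<Rightarrow> complex) \<Rightarrow> 'v \<Rightarrow> 'v \<Rightarrow> 'v \<Rightarrow> real" where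
  "angular_invariant ip u v w = Arg (ip u v * ip v w * ip w u)"

definition LF :: "('v \<Rightarrow> 'v \<Rightarrow> complex) \<Rightarrow> 'v \<Rightarrow> 'v \<Rightarrow> 'v \<Rightarrow> real" where
  "LF ip u v w =
     sqrt (1 / (delta ip u v)\<^sup>2 * (cmod (1 - (ip v u * ip u w) / (ip v w * ip u u)))\<^sup>2)"

end

theory Submission
  imports Defs
begin

text \<open>
  A point \<open>z\<close> of the ball is represented by the vector \<open>(1, z)\<close>, scaled to a unit vector \<open>Z\<close> of the
  form \<open>[(p, u), (q, w)] = p * cnj q - hprod u w\<close>. This form is negative definite on \<open>Z\<^sup>\<bottom>\<close>, and
  \<open>cosh (d z w) = |[Z, W]|\<close> defines the distance with \<open>rho = tanh d\<close>. By Cauchy-Schwarz on \<open>Z\<^sup>\<bottom>\<close>,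
  the Gram determinant of three unit vectors,
  \<open>1 + 2 * Re ([X, Y] * [Y, Z] * [Z, X]) - |[X, Y]|\<^sup>2 - |[Y, Z]|\<^sup>2 - |[Z, X]|\<^sup>2\<close>, is nonnegative; this
  gives the triangle inequality for \<open>d\<close>, and since \<open>rho\<close> and \<open>d\<close> agree to first order at the
  diagonal, \<open>d\<close> is the length metric of \<open>rho\<close>.

  The condition on \<open>LF\<close> says that the Gram determinant vanishes, the one on the angular invariant that
  the triple product is positive. Three points at parameters \<open>r, s, t\<close> of a geodesic have
  \<open>|[X, Y]| = cosh (r - s)\<close> and so on, for which
  \<open>1 + 2 * |[X, Y]| * |[Y, Z]| * |[Z, X]| = |[X, Y]|\<^sup>2 + |[Y, Z]|\<^sup>2 + |[Z, X]|\<^sup>2\<close>; nonnegativity of the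
  Gram determinant then forces the triple product to be positive. Conversely, after a choice of
  phases all products are positive, and the vanishing determinant puts the third vector on
  the line \<open>t \<mapsto> cosh t X + sinh t V\<close> through the other two.
\<close>

section \<open>The Lorentzian Hermitian form\<close>

lemma hprod_add_left: "hprod (x + y) z = hprod x z + hprod y z"
  by (simp add: hprod_def sum.distrib algebra_simps)

lemma hprod_diff_left: "hprod (x - y) z = hprod x z - hprod y z"
  by (simp add: hprod_def sum_subtractf algebra_simps)

lemma hprod_scale_left: "hprod (c *s x) z = c * hprod x z"
  by (simp add: hprod_def sum_distrib_left mult_ac)

lemma hprod_cnj: "cnj (hprod x y) = hprod y x"
  by (simp add: hprod_def mult.commute)

lemma hprod_self: "hprod z z = of_real ((norm z)\<^sup>2)"
proof -
  have "hprod z z = of_real (\<Sum>i\<in>UNIV. (cmod (z $ i))\<^sup>2)"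
    unfolding hprod_def by (simp only: complex_mult_cnj cmod_power2 of_real_sum)
  then show ?thesis
    by (simp add: norm_vec_def L2_set_def sum_nonneg)
qed

lemma cmod_hprod_le: "cmod (hprod u w) \<le> norm u * norm w"
proof -
  have "cmod (hprod u w) \<le> (\<Sum>i\<in>UNIV. \<bar>cmod (u $ i)\<bar> * \<bar>cmod (w $ i)\<bar>)"
    unfolding hprod_def by (rule order_trans[OF norm_sum]) (simp add: norm_mult)
  also have "\<dots> \<le> norm u * norm w"
    unfolding norm_vec_def by (rule L2_set_mult_ineq)
  finally show ?thesis .
qed

lemma norm_scale: "norm (c *s x) = cmod c * norm (x :: complex ^ 'n)"
  by (simp add: norm_vec_def norm_mult L2_set_right_distrib)

lemma of_real_cmod_square: "(complex_of_real (cmod z))\<^sup>2 = z * cnj z"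
  by (metis complex_norm_square of_real_power)

definition lform :: "complex \<times> (complex ^ 'n) \<Rightarrow> complex \<times> (complex ^ 'n) \<Rightarrow> complex" where
  "lform P Q = fst P * cnj (fst Q) - hprod (snd P) (snd Q)"

definition cscale :: "complex \<Rightarrow> complex \<times> (complex ^ 'n) \<Rightarrow> complex \<times> (complex ^ 'n)" where
  "cscale c P = (c * fst P, c *s snd P)"

lemma lform_cnj: "cnj (lform P Q) = lform Q P"
  by (simp add: lform_def hprod_cnj mult.commute)

lemma lform_add_left: "lform (P + Q) R = lform P R + lform Q R"
  by (simp add: lform_def hprod_add_left algebra_simps)

lemma lform_diff_left: "lform (P - Q) R = lform P R - lform Q R"
  by (simp add: lform_def hprod_diff_left algebra_simps)

lemma lform_scale_left: "lform (cscale c P) R = c * lform P R"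
  by (simp add: lform_def cscale_def hprod_scale_left algebra_simps)

lemma lform_add_right: "lform R (P + Q) = lform R P + lform R Q"
  by (metis lform_cnj lform_add_left complex_cnj_add)

lemma lform_diff_right: "lform R (P - Q) = lform R P - lform R Q"
  by (metis lform_cnj lform_diff_left complex_cnj_diff)

lemma lform_scale_right: "lform R (cscale c P) = cnj c * lform R P"
  by (metis lform_cnj lform_scale_left complex_cnj_mult)

lemmas lform_simps = lform_add_left lform_diff_left lform_scale_left
  lform_add_right lform_diff_right lform_scale_right

lemma lform_self: "lform P P = of_real ((cmod (fst P))\<^sup>2 - (norm (snd P))\<^sup>2)"
  by (simp add: lform_def hprod_self of_real_cmod_square)

lemma lform_self_Re: "lform P P = of_real (Re (lform P P))"
  by (simp add: lform_self)

lemma lform_mult_swap: "lform P Q * lform Q P = of_real ((cmod (lform P Q))\<^sup>2)"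
  by (metis complex_norm_square lform_cnj)

lemma cmod_lform_swap: "cmod (lform P Q) = cmod (lform Q P)"
  by (metis lform_cnj complex_mod_cnj)

text \<open>With \<open>P = (p, u)\<close> and \<open>E = (q, w)\<close>, orthogonality and
  Cauchy-Schwarz for \<open>hprod\<close> give |p| |q| <= |u| |w|. Since |u| < |p|, this forces |q|
  <= |w|, with equality only for \<open>w = 0\<close>.\<close>

lemma lform_orthogonal_neg:
  assumes "Re (lform P P) > 0" and "lform P E = 0"
  shows "Re (lform E E) \<le> 0" and "Re (lform E E) = 0 \<Longrightarrow> E = 0"
proof -
  let ?p = "cmod (fst P)" and ?u = "norm (snd P)" and ?q = "cmod (fst E)" and ?w = "norm (snd E)"
  have pu: "?u\<^sup>2 < ?p\<^sup>2"
    using assms(1) by (simp add: lform_self)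
  have "fst P * cnj (fst E) = hprod (snd P) (snd E)"
    using assms(2) by (simp add: lform_def)
  then have "?p * ?q = cmod (hprod (snd P) (snd E))"
    by (metis norm_mult complex_mod_cnj)
  then have "?p * ?q \<le> ?u * ?w"
    using cmod_hprod_le by metis
  then have "(?p * ?q)\<^sup>2 \<le> (?u * ?w)\<^sup>2"
    by (intro power_mono) auto
  then have le: "?p\<^sup>2 * ?q\<^sup>2 \<le> ?u\<^sup>2 * ?w\<^sup>2"
    by (simp add: power_mult_distrib)
  have p0: "?p\<^sup>2 > 0"
    using pu by (meson le_less_trans zero_le_power2)
  have "?u\<^sup>2 * ?w\<^sup>2 \<le> ?p\<^sup>2 * ?w\<^sup>2"
    using less_imp_le[OF pu] by (rule mult_right_mono) simp
  then have "?p\<^sup>2 * ?q\<^sup>2 \<le> ?p\<^sup>2 * ?w\<^sup>2"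
    using le by linarith
  then show "Re (lform E E) \<le> 0"
    using p0 by (simp add: lform_self)
  assume "Re (lform E E) = 0"
  then have qw: "?q\<^sup>2 = ?w\<^sup>2"
    by (simp add: lform_self)
  have "?w\<^sup>2 \<le> 0"
  proof (rule ccontr)
    assume "\<not> ?w\<^sup>2 \<le> 0"
    then have "?u\<^sup>2 * ?w\<^sup>2 < ?p\<^sup>2 * ?w\<^sup>2"
      using pu by (intro mult_strict_right_mono) auto
    then show False
      using le qw by simp
  qed
  with qw show "E = 0"
    by (simp add: prod_eq_iff)
qed

text \<open>The usual proof of Cauchy-Schwarz with signs reversed: \<open>F\<close> is
  \<open>W\<close> minus its component along \<open>U\<close>, and [F, F] <= 0 is multiplied by the
  negative number [U, U]. A null \<open>U\<close> is zero by definiteness.\<close>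

lemma lform_orthogonal_CS:
  assumes P: "Re (lform P P) > 0" and U: "lform P U = 0" and W: "lform P W = 0"
  shows "(cmod (lform U W))\<^sup>2 \<le> Re (lform U U) * Re (lform W W)"
proof (cases "Re (lform U U) = 0")
  case True
  then have "U = 0"
    using lform_orthogonal_neg(2)[OF P U] by simp
  then show ?thesis
    by (simp add: lform_def hprod_def)
next
  case False
  define r where "r = Re (lform U U)"
  have rU: "lform U U = of_real r"
    unfolding r_def by (rule lform_self_Re)
  have r: "r < 0"
    using False lform_orthogonal_neg(1)[OF P U] by (simp add: r_def)
  define F where "F = W - cscale (lform W U / of_real r) U"
  have "lform P F = 0"
    by (simp add: F_def lform_simps U W)
  then have neg: "Re (lform F F) \<le> 0"
    using lform_orthogonal_neg(1)[OF P] by blast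
  have "lform F F = lform W W - lform W U * lform U W / of_real r"
    using r by (simp add: F_def lform_simps rU lform_cnj field_simps)
  also have "\<dots> = of_real (Re (lform W W)) - of_real ((cmod (lform U W))\<^sup>2) / of_real r"
    by (metis lform_self_Re lform_mult_swap mult.commute)
  also have "\<dots> = of_real (Re (lform W W) - (cmod (lform U W))\<^sup>2 / r)"
    by simp
  finally have "Re (lform W W) - (cmod (lform U W))\<^sup>2 / r \<le> 0"
    using neg by (metis Re_complex_of_real)
  then show ?thesis
    using r unfolding r_def[symmetric] by (simp add: field_simps)
qed

text \<open>Removing from \<open>Q\<close> and \<open>R\<close> their components along
  \<open>P\<close> leaves \<open>U\<close> and \<open>W\<close> orthogonal to \<open>P\<close>.
  Their two by two Gram determinant equals the three by three one, because [P, P] = 1, and it is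
  nonnegative by \<open>lform_orthogonal_CS\<close>.\<close>

lemma gram_det_nonneg:
  assumes "lform P P = 1" "lform Q Q = 1" "lform R R = 1"
  shows "(cmod (lform P Q))\<^sup>2 + (cmod (lform Q R))\<^sup>2 + (cmod (lform R P))\<^sup>2
    \<le> 1 + 2 * Re (lform P Q * lform Q R * lform R P)"
proof -
  define a b c where "a = lform P Q" and "b = lform Q R" and "c = lform R P"
  have swap: "lform Q P = cnj a" "lform R Q = cnj b" "lform P R = cnj c"
    by (simp_all add: a_def b_def c_def lform_cnj)
  define U where "U = Q - cscale (cnj a) P"
  define W where "W = R - cscale c P"
  have PU: "lform P U = 0" and PW: "lform P W = 0"
    by (simp_all add: U_def W_def lform_simps assms swap a_def[symmetric])
  have UU: "lform U U = of_real (1 - (cmod a)\<^sup>2)"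
    by (simp add: U_def lform_simps assms swap a_def[symmetric] of_real_cmod_square algebra_simps)
  have WW: "lform W W = of_real (1 - (cmod c)\<^sup>2)"
    by (simp add: W_def lform_simps assms swap c_def[symmetric] of_real_cmod_square algebra_simps)
  have UW: "lform U W = b - cnj a * cnj c"
    by (simp add: U_def W_def lform_simps assms swap b_def[symmetric] c_def[symmetric] algebra_simps)
  have "(cmod (b - cnj a * cnj c))\<^sup>2 \<le> (1 - (cmod a)\<^sup>2) * (1 - (cmod c)\<^sup>2)"
    using lform_orthogonal_CS[OF _ PU PW] by (simp add: UU UW WW assms del: of_real_diff)
  moreover have "(cmod (b - cnj a * cnj c))\<^sup>2
      = (cmod b)\<^sup>2 + (cmod a)\<^sup>2 * (cmod c)\<^sup>2 - 2 * Re (a * b * c)"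
    unfolding cmod_power2 by (simp add: power2_eq_square algebra_simps)
  ultimately show ?thesis
    by (simp add: algebra_simps a_def b_def c_def)
qed

section \<open>The hyperboloid model\<close>

definition lift :: "complex ^ 'n \<Rightarrow> complex \<times> (complex ^ 'n)" where
  "lift z = cscale (of_real (1 / sqrt (1 - (norm z)\<^sup>2))) (1, z)"

text \<open>The affine chart on homogeneous coordinates. Unit vectors have a nonzero first
  coordinate by \<open>lform_unit_fst\<close>, so there the division is genuine.\<close>

definition proj :: "complex \<times> (complex ^ 'n) \<Rightarrow> complex ^ 'n" where
  "proj P = (1 / fst P) *s snd P"

lemma ball_iff: "z \<in> ball 0 1 \<longleftrightarrow> 1 - (norm z)\<^sup>2 > 0"
  by (simp add: power_less_one_iff abs_square_less_1)

lemma lform_lift: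
  "lform (lift z) (lift w) = (1 - hprod z w) * of_real (1 / sqrt (1 - (norm z)\<^sup>2) * (1 / sqrt (1 - (norm w)\<^sup>2)))"
  by (simp add: lift_def lform_simps) (simp add: lform_def)

lemma lform_lift_self:
  assumes "z \<in> ball 0 1"
  shows "lform (lift z) (lift z) = 1"
proof -
  have pos: "1 - (norm z)\<^sup>2 > 0"
    using assms by (simp only: ball_iff)
  have "lform (lift z) (lift z)
      = of_real ((1 - (norm z)\<^sup>2) * (1 / sqrt (1 - (norm z)\<^sup>2) * (1 / sqrt (1 - (norm z)\<^sup>2))))"
    unfolding lform_lift hprod_self by simp
  also have "(1 - (norm z)\<^sup>2) * (1 / sqrt (1 - (norm z)\<^sup>2) * (1 / sqrt (1 - (norm z)\<^sup>2))) = 1"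
    using pos by simp
  finally show ?thesis by simp
qed

lemma proj_cscale: "c \<noteq> 0 \<Longrightarrow> proj (cscale c P) = proj P"
  by (simp add: proj_def cscale_def vec_eq_iff)

lemma proj_lift: "z \<in> ball 0 1 \<Longrightarrow> proj (lift z) = z"
  unfolding lift_def ball_iff by (subst proj_cscale) (simp_all add: proj_def vec_eq_iff)

lemma lform_unit_fst: "lform P P = 1 \<Longrightarrow> fst P \<noteq> 0"
proof
  assume "lform P P = 1" "fst P = 0"
  then have "- (norm (snd P))\<^sup>2 = 1"
    by (metis lform_self of_real_eq_1_iff norm_zero power_zero_numeral diff_0)
  then show False
    by (metis neg_le_0_iff_le not_one_le_zero zero_le_power2)
qed

text \<open>Unit representatives of one point differ only by a phase, so any of them may replace
  \<open>lift\<close> when moduli of the form are computed.\<close>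

lemma lform_unit_proj:
  assumes "lform P P = 1"
  shows "proj P \<in> ball 0 1" and "\<exists>u. cmod u = 1 \<and> lift (proj P) = cscale u P"
proof -
  have f: "fst P \<noteq> 0"
    using assms by (rule lform_unit_fst)
  have n: "norm (proj P) = norm (snd P) / cmod (fst P)"
    by (simp add: proj_def norm_scale norm_divide)
  have "(cmod (fst P))\<^sup>2 - (norm (snd P))\<^sup>2 = 1"
    using assms by (metis lform_self of_real_eq_1_iff)
  moreover have "1 - (norm (proj P))\<^sup>2 = ((cmod (fst P))\<^sup>2 - (norm (snd P))\<^sup>2) / (cmod (fst P))\<^sup>2"
    using f by (simp add: n power_divide diff_divide_distrib)
  ultimately have e: "1 - (norm (proj P))\<^sup>2 = 1 / (cmod (fst P))\<^sup>2"
    by simp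
  then show "proj P \<in> ball 0 1"
    unfolding ball_iff using f by simp
  have "lift (proj P) = cscale (of_real (cmod (fst P)) / fst P) P"
    unfolding lift_def e using f
    by (simp add: cscale_def proj_def vec_eq_iff real_sqrt_divide)
  moreover have "cmod (of_real (cmod (fst P)) / fst P) = 1"
    using f by (simp add: norm_divide)
  ultimately show "\<exists>u. cmod u = 1 \<and> lift (proj P) = cscale u P"
    by blast
qed

definition hcosh :: "complex ^ 'n \<Rightarrow> complex ^ 'n \<Rightarrow> real" where
  "hcosh z w = cmod (lform (lift z) (lift w))"

definition hdist :: "complex ^ 'n \<Rightarrow> complex ^ 'n \<Rightarrow> real" where
  "hdist z w = arcosh (hcosh z w)"

lemma hcosh_proj:
  assumes "lform P P = 1" "lform Q Q = 1"
  shows "hcosh (proj P) (proj Q) = cmod (lform P Q)"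
proof -
  obtain u v where "cmod u = 1" "lift (proj P) = cscale u P" "cmod v = 1" "lift (proj Q) = cscale v Q"
    using assms lform_unit_proj(2) by metis
  then show ?thesis
    by (simp add: hcosh_def lform_simps norm_mult)
qed

lemma hcosh_commute: "hcosh z w = hcosh w z"
  by (simp add: hcosh_def cmod_lform_swap)

lemma hcosh_self: "z \<in> ball 0 1 \<Longrightarrow> hcosh z z = 1"
  by (simp add: hcosh_def lform_lift_self)

text \<open>\<open>E\<close> is the part of \<open>lift w\<close> orthogonal to
  \<open>lift z\<close>, and [E, E] = 1 - |c|^2 is nonpositive. If it vanishes then
  \<open>E = 0\<close>, so the lifts are proportional and represent the same point.\<close>

lemma
  assumes z: "z \<in> ball 0 1" and w: "w \<in> ball 0 1"
  shows hcosh_ge_1: "1 \<le> hcosh z w" and hcosh_eq_1: "hcosh z w = 1 \<Longrightarrow> z = w"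
proof -
  define c where "c = lform (lift w) (lift z)"
  define E where "E = lift w - cscale c (lift z)"
  have c': "lform (lift z) (lift w) = cnj c"
    by (simp add: c_def lform_cnj)
  have ort: "lform (lift z) E = 0"
    by (simp add: E_def lform_simps lform_lift_self[OF z] c')
  have "lform E E = of_real (1 - (cmod c)\<^sup>2)"
    by (simp add: E_def lform_simps lform_lift_self[OF z] lform_lift_self[OF w] c' c_def[symmetric] of_real_cmod_square algebra_simps)
  then have EE: "Re (lform E E) = 1 - (cmod c)\<^sup>2"
    by simp
  have h: "hcosh z w = cmod c"
    by (simp add: hcosh_def c')
  have pos: "Re (lform (lift z) (lift z)) > 0"
    by (simp add: lform_lift_self[OF z])
  have "1\<^sup>2 \<le> (cmod c)\<^sup>2"
    using lform_orthogonal_neg(1)[OF pos ort] EE by simp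
  then show "1 \<le> hcosh z w"
    unfolding h by (rule power2_le_imp_le) simp
  assume "hcosh z w = 1"
  then have c1: "cmod c = 1" and "E = 0"
    using lform_orthogonal_neg(2)[OF pos ort] EE h by auto
  then have "lift w = cscale c (lift z)"
    by (simp add: E_def)
  then have "proj (lift w) = proj (lift z)"
    using c1 by (metis proj_cscale norm_zero zero_neq_one)
  then show "z = w"
    using z w by (simp add: proj_lift)
qed

lemma hdist_nonneg: "z \<in> ball 0 1 \<Longrightarrow> w \<in> ball 0 1 \<Longrightarrow> 0 \<le> hdist z w"
  unfolding hdist_def by (rule arcosh_nonneg_real) (rule hcosh_ge_1)

lemma cosh_hdist: "z \<in> ball 0 1 \<Longrightarrow> w \<in> ball 0 1 \<Longrightarrow> cosh (hdist z w) = hcosh z w"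
  unfolding hdist_def by (rule cosh_arcosh_real) (rule hcosh_ge_1)

lemma rho_hcosh:
  assumes "z \<in> ball 0 1" "w \<in> ball 0 1"
  shows "rho z w = sqrt (1 - 1 / (hcosh z w)\<^sup>2)"
proof -
  have "1 - (norm z)\<^sup>2 > 0" "1 - (norm w)\<^sup>2 > 0"
    using assms by (simp_all only: ball_iff)
  then have "(hcosh z w)\<^sup>2 = (cmod (1 - hprod z w))\<^sup>2 / ((1 - (norm z)\<^sup>2) * (1 - (norm w)\<^sup>2))"
    unfolding hcosh_def lform_lift norm_mult norm_of_real
    by (simp add: power_mult_distrib power_divide)
  then show ?thesis
    by (simp add: rho_def)
qed

lemma rho_tanh:
  assumes "z \<in> ball 0 1" "w \<in> ball 0 1"
  shows "rho z w = tanh (hdist z w)"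
proof -
  have "1 - 1 / (hcosh z w)\<^sup>2 = (tanh (hdist z w))\<^sup>2"
    unfolding cosh_hdist[OF assms, symmetric] tanh_def power_divide sinh_square_eq
    by (simp add: field_simps)
  then show ?thesis
    using hdist_nonneg[OF assms] by (simp add: rho_hcosh[OF assms])
qed

text \<open>With the real part of the triple product bounded by its modulus, the Gram inequality
  reads (c - x y)^2 <= (x^2 - 1)(y^2 - 1) in the three values of \<open>hcosh\<close>. The right
  side is the square of sinh \<alpha> sinh \<beta>, so c <= cosh (\<alpha> + \<beta>).\<close>

lemma hdist_triangle:
  assumes z: "z \<in> ball 0 1" and u: "u \<in> ball 0 1" and w: "w \<in> ball 0 1"
  shows "hdist z w \<le> hdist z u + hdist u w"
proof -
  let ?x = "hcosh z u" and ?y = "hcosh u w" and ?c = "hcosh z w"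
  let ?\<alpha> = "hdist z u" and ?\<beta> = "hdist u w"
  have "Re (lform (lift z) (lift u) * lform (lift u) (lift w) * lform (lift w) (lift z)) \<le> ?x * ?y * ?c"
    by (rule order_trans[OF complex_Re_le_cmod])
      (simp add: norm_mult hcosh_def cmod_lform_swap[of "lift w" "lift z"])
  then have "?x\<^sup>2 + ?y\<^sup>2 + ?c\<^sup>2 \<le> 1 + 2 * (?x * ?y * ?c)"
    using gram_det_nonneg[OF lform_lift_self lform_lift_self lform_lift_self, OF z u w]
    by (simp add: hcosh_def cmod_lform_swap[of "lift w" "lift z"])
  then have "(?c - ?x * ?y)\<^sup>2 \<le> (?x\<^sup>2 - 1) * (?y\<^sup>2 - 1)"
    by (simp add: power2_eq_square algebra_simps)
  also have "\<dots> = (sinh ?\<alpha> * sinh ?\<beta>)\<^sup>2"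
    by (simp add: power_mult_distrib sinh_square_eq cosh_hdist[OF z u] cosh_hdist[OF u w] cosh_hdist[OF z w])
  finally have "\<bar>?c - ?x * ?y\<bar> \<le> \<bar>sinh ?\<alpha> * sinh ?\<beta>\<bar>"
    by (simp only: abs_le_square_iff)
  then have "?c \<le> ?x * ?y + sinh ?\<alpha> * sinh ?\<beta>"
    by (simp add: abs_mult hdist_nonneg[OF z u] hdist_nonneg[OF u w] hdist_nonneg[OF z w])
  then have "cosh (hdist z w) \<le> cosh (?\<alpha> + ?\<beta>)"
    by (simp add: cosh_add cosh_hdist[OF z u] cosh_hdist[OF u w] cosh_hdist[OF z w])
  then show ?thesis
    by (simp add: cosh_real_nonneg_le_iff hdist_nonneg[OF z u] hdist_nonneg[OF u w] hdist_nonneg[OF z w])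
qed

section \<open>Geodesic lines and the length metric\<close>

text \<open>For \<open>P\<close>, \<open>V\<close> orthogonal with [P, P] = 1 and [V, V] = -1, the
  vectors before projection trace a branch of the hyperbola in the real plane spanned by
  \<open>P\<close> and \<open>V\<close>.\<close>

definition hline :: "complex \<times> (complex ^ 'n) \<Rightarrow> complex \<times> (complex ^ 'n) \<Rightarrow> real \<Rightarrow> complex ^ 'n" where
  "hline P V t = proj (cscale (of_real (cosh t)) P + cscale (of_real (sinh t)) V)"

context
  fixes P V :: "complex \<times> (complex ^ 'n)"
  assumes PP: "lform P P = 1" and PV: "lform P V = 0" and VV: "lform V V = -1"
begin

lemma lform_hline:
  "lform (cscale (of_real (cosh s)) P + cscale (of_real (sinh s)) V)
     (cscale (of_real (cosh t)) P + cscale (of_real (sinh t)) V) = of_real (cosh (s - t))"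
proof -
  have VP: "lform V P = 0"
    using PV by (metis lform_cnj complex_cnj_zero)
  show ?thesis
    by (simp add: lform_simps PP PV VV VP cosh_diff)
qed

lemma hline_in_ball: "hline P V t \<in> ball 0 1"
  unfolding hline_def by (rule lform_unit_proj) (simp add: lform_hline)

lemma hdist_hline: "hdist (hline P V s) (hline P V t) = \<bar>s - t\<bar>"
proof -
  have "hcosh (hline P V s) (hline P V t) = cosh (s - t)"
    unfolding hline_def by (subst hcosh_proj) (simp_all add: lform_hline)
  also have "\<dots> = cosh \<bar>s - t\<bar>"
    by (simp add: abs_if cosh_minus[of "s - t", symmetric] del: cosh_minus)
  finally show ?thesis
    by (simp only: hdist_def arcosh_cosh_real abs_ge_zero)
qed

lemma continuous_hline: "continuous_on A (hline P V)"
proof -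
  have "fst (cscale (of_real (cosh t)) P + cscale (of_real (sinh t)) V) \<noteq> 0" for t :: real
    by (rule lform_unit_fst) (simp add: lform_hline)
  then have "of_real (cosh t) * fst P + of_real (sinh t) * fst V \<noteq> 0" for t :: real
    by (simp add: cscale_def)
  then show ?thesis
    unfolding hline_def proj_def cscale_def vector_scalar_mult_def
    by (auto intro!: continuous_intros)
qed

end

text \<open>\<open>V\<close> is the component of \<open>Q\<close> orthogonal to \<open>P\<close>,
  normalised. As [Q, P] is real, \<open>Q\<close> lies in the real plane of \<open>P\<close> and
  \<open>V\<close>, at parameter \<alpha>.\<close>

lemma hline_through:
  assumes P: "lform P P = 1" and Q: "lform Q Q = 1" and PQ: "lform Q P = of_real (cosh \<alpha>)"
    and \<alpha>: "\<alpha> \<noteq> 0"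
  defines "V \<equiv> cscale (of_real (1 / sinh \<alpha>)) (Q - cscale (of_real (cosh \<alpha>)) P)"
  shows "lform P V = 0" and "lform V V = -1" and "hline P V 0 = proj P" and "hline P V \<alpha> = proj Q"
proof -
  have s: "sinh \<alpha> \<noteq> 0"
    using \<alpha> by simp
  have PQ': "lform P Q = of_real (cosh \<alpha>)"
    using PQ by (metis lform_cnj complex_cnj_complex_of_real)
  show "lform P V = 0"
    by (simp add: V_def lform_simps P PQ')
  have "lform V V = of_real ((1 / sinh \<alpha>) * ((1 / sinh \<alpha>) * (1 - (cosh \<alpha>)\<^sup>2)))"
    by (simp add: V_def lform_simps P Q PQ PQ' power2_eq_square)
  also have "(1 / sinh \<alpha>) * ((1 / sinh \<alpha>) * (1 - (cosh \<alpha>)\<^sup>2)) = -1"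
    using s by (simp add: cosh_square_eq) (simp add: power2_eq_square)
  finally show "lform V V = -1"
    by simp
  have "cscale (of_real (cosh 0)) P + cscale (of_real (sinh 0)) V = P"
    by (simp add: cscale_def prod_eq_iff)
  then show "hline P V 0 = proj P"
    by (simp add: hline_def)
  have "cscale (of_real (cosh \<alpha>)) P + cscale (of_real (sinh \<alpha>)) V = Q"
    using s by (simp add: V_def cscale_def prod_eq_iff vec_eq_iff)
  then show "hline P V \<alpha> = proj Q"
    by (simp add: hline_def)
qed

text \<open>Supplies the real nonnegative product that \<open>hline_through\<close> asks for,
  without moving the point that \<open>Q\<close> represents.\<close>

lemma phase_normalise:
  fixes P Q :: "complex \<times> (complex ^ 'n)"
  assumes "lform Q Q = 1"
  obtains u where "cmod u = 1" and "lform (cscale u Q) P = of_real (cmod (lform Q P))"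
    and "lform (cscale u Q) (cscale u Q) = 1" and "proj (cscale u Q) = proj Q"
proof -
  define a where "a = lform Q P"
  \<comment> \<open>\<open>sgn 0\<close> is 0 and hence no phase, so the value 1 is used
    there.\<close>
  define u where "u = (if a = 0 then 1 else cnj (sgn a))"
  have u: "cmod u = 1" "u * a = of_real (cmod a)"
    by (auto simp: u_def sgn_eq norm_divide of_real_cmod_square[symmetric] mult.commute[of "cnj a"]
      power2_eq_square)
  show ?thesis
  proof (rule that)
    show "cmod u = 1" by fact
    show "lform (cscale u Q) P = of_real (cmod (lform Q P))"
      using u by (simp add: lform_simps a_def)
    show "lform (cscale u Q) (cscale u Q) = 1"
      using of_real_cmod_square[of u] u by (simp add: lform_simps assms mult.commute)
    show "proj (cscale u Q) = proj Q"
      using u by (intro proj_cscale) auto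
  qed
qed

text \<open>The line through the two points, with its parameter rescaled to [0, 1]. Equal points
  determine no direction \<open>V\<close> and get the constant path.\<close>

lemma constant_speed_path:
  fixes z w :: "complex ^ 'n"
  assumes z: "z \<in> ball 0 1" and w: "w \<in> ball 0 1"
  obtains g where "path g" "path_image g \<subseteq> ball 0 1" "pathstart g = z" "pathfinish g = w"
    "\<And>s t. hdist (g s) (g t) = \<bar>s - t\<bar> * hdist z w"
proof (cases "z = w")
  case True
  show ?thesis
  proof (rule that[of "\<lambda>_. z"])
    show "hdist z z = \<bar>s - t\<bar> * hdist z w" for s t
      using z True by (simp add: hdist_def hcosh_self)
  qed (use z True in \<open>auto simp: path_def path_image_def pathstart_def pathfinish_def\<close>)
next
  case False
  obtain u where u: "lform (cscale u (lift w)) (lift z) = of_real (cmod (lform (lift w) (lift z)))"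
    "lform (cscale u (lift w)) (cscale u (lift w)) = 1" "proj (cscale u (lift w)) = proj (lift w)"
    using phase_normalise[OF lform_lift_self[OF w], of "lift z"] by metis
  define \<alpha> where "\<alpha> = hdist z w"
  have Q: "lform (cscale u (lift w)) (lift z) = of_real (cosh \<alpha>)"
    by (simp add: u \<alpha>_def cosh_hdist[OF z w] hcosh_def cmod_lform_swap)
  have "cosh \<alpha> \<noteq> 1"
    using hcosh_eq_1[OF z w] False by (auto simp: \<alpha>_def cosh_hdist[OF z w])
  then have \<alpha>: "\<alpha> \<noteq> 0"
    by auto
  obtain V where V: "lform (lift z) V = 0" "lform V V = -1" "hline (lift z) V 0 = z"
      "hline (lift z) V \<alpha> = w"
    using hline_through[OF lform_lift_self[OF z] u(2) Q \<alpha>] u(3) z w by (metis proj_lift)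
  note line = lform_lift_self[OF z] V(1,2)
  show ?thesis
  proof (rule that[of "\<lambda>t. hline (lift z) V (\<alpha> * t)"])
    show "path (\<lambda>t. hline (lift z) V (\<alpha> * t))"
      unfolding path_def
      by (rule continuous_on_compose2[OF continuous_hline[OF line, of UNIV]])
        (auto intro!: continuous_intros)
    show "hdist (hline (lift z) V (\<alpha> * s)) (hline (lift z) V (\<alpha> * t)) = \<bar>s - t\<bar> * hdist z w" for s t
      using hdist_nonneg[OF z w]
      by (simp add: hdist_hline[OF line] \<alpha>_def right_diff_distrib[symmetric] abs_mult)
  qed (use V hline_in_ball[OF line] in \<open>auto simp: path_image_def pathstart_def pathfinish_def\<close>)
qed

section \<open>Lengths of paths with respect to \<open>rho\<close>\<close>

lemma sum_sorted_steps_le: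
  fixes ts :: "real list"
  assumes "sorted ts" "set ts \<subseteq> {0..1}"
  shows "(\<Sum>i<length ts - 1. \<bar>ts ! i - ts ! Suc i\<bar>) \<le> 1"
proof (cases "ts = []")
  case False
  have "(\<Sum>i<length ts - 1. \<bar>ts ! i - ts ! Suc i\<bar>) = (\<Sum>i<length ts - 1. ts ! Suc i - ts ! i)"
    using assms(1) by (intro sum.cong) (auto simp: sorted_iff_nth_Suc)
  also have "\<dots> = ts ! (length ts - 1) - ts ! 0"
    by (rule sum_lessThan_telescope)
  also have "\<dots> \<le> 1 - 0"
    using False assms(2) by (intro diff_mono) (auto dest!: nth_mem simp: subset_iff)
  finally show ?thesis by simp
qed simp

text \<open>The domain is an arbitrary space because the application is on the square of the
  parameter interval.\<close>

lemma continuous_hcosh: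
  fixes g h :: "'a::topological_space \<Rightarrow> complex ^ 'n"
  assumes "continuous_on A g" "continuous_on A h" "g ` A \<subseteq> ball 0 1" "h ` A \<subseteq> ball 0 1"
  shows "continuous_on A (\<lambda>t. hcosh (g t) (h t))"
proof -
  have "1 - (norm (g t))\<^sup>2 > 0" "1 - (norm (h t))\<^sup>2 > 0" if "t \<in> A" for t
    using assms(3,4) that unfolding ball_iff[symmetric] by auto
  then have "1 - (norm (g t))\<^sup>2 \<noteq> 0" "1 - (norm (h t))\<^sup>2 \<noteq> 0" if "t \<in> A" for t
    using that by (metis less_irrefl)+
  then show ?thesis
    unfolding hcosh_def lform_lift hprod_def
    using assms(1,2) by (auto intro!: continuous_intros)
qed

lemma hdist_polygon:
  assumes "\<And>i. i \<le> N \<Longrightarrow> p i \<in> ball 0 1"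
  shows "hdist (p 0) (p N) \<le> (\<Sum>i<N. hdist (p i) (p (Suc i)))"
  using assms
proof (induction N)
  case 0
  then show ?case by (simp add: hdist_def hcosh_self)
next
  case (Suc N)
  have "hdist (p 0) (p (Suc N)) \<le> hdist (p 0) (p N) + hdist (p N) (p (Suc N))"
    by (rule hdist_triangle; rule Suc.prems; simp)
  with Suc show ?case by simp
qed

lemma le_sinh_real:
  fixes x :: real
  assumes "0 \<le> x"
  shows "x \<le> sinh x"
proof -
  have "sinh 0 - 0 \<le> sinh x - x"
    using assms cosh_real_ge_1
    by (intro DERIV_nonneg_imp_nondecreasing[of 0 x "\<lambda>x. sinh x - x"])
      (auto intro!: derivative_eq_intros exI)
  then show ?thesis by simp
qed

lemma tanh_real_le_self:
  fixes x :: real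
  assumes "0 \<le> x"
  shows "tanh x \<le> x"
proof -
  have "0 - tanh 0 \<le> x - tanh x"
    using assms
    by (intro DERIV_nonneg_imp_nondecreasing[of 0 x "\<lambda>x. x - tanh x"])
      (auto intro!: derivative_eq_intros exI[of _ "(tanh _)\<^sup>2"])
  then show ?thesis by simp
qed

text \<open>From d <= sinh d = cosh d tanh d. For nearby points \<open>C\<close> can be taken close
  to 1, which makes this a first order converse of \<open>rho\<close> <=
  \<open>hdist\<close>.\<close>

lemma hdist_le_rho:
  assumes "z \<in> ball 0 1" "w \<in> ball 0 1" "hcosh z w \<le> C"
  shows "hdist z w \<le> C * rho z w"
proof -
  let ?d = "hdist z w"
  have "?d \<le> sinh ?d"
    using hdist_nonneg assms by (intro le_sinh_real) auto
  also have "\<dots> = cosh ?d * tanh ?d"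
    by (simp add: tanh_def)
  also have "\<dots> \<le> C * tanh ?d"
    using assms hdist_nonneg by (intro mult_right_mono) (auto simp: cosh_hdist)
  finally show ?thesis
    using assms by (simp add: rho_tanh)
qed

text \<open>On a fine partition consecutive points have \<open>hcosh\<close> at most 1 + e, so the
  polygonal sum of \<open>hdist\<close> is at most 1 + e times that of \<open>rho\<close>. The
  triangle inequality bounds the former from below; then e tends to 0.\<close>

lemma hdist_le_rho_length:
  fixes g :: "real \<Rightarrow> complex ^ 'n"
  assumes g: "path g" "path_image g \<subseteq> ball 0 1"
  shows "ereal (hdist (g 0) (g 1)) \<le> rho_length g"
proof -
  have in_ball: "g t \<in> ball 0 1" if "t \<in> {0..1}" for t
    using g(2) that unfolding path_image_def by blast
  have key: "ereal (hdist (g 0) (g 1) / (1 + e)) \<le> rho_length g" if e: "e > 0" for e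
  proof -
    \<comment> \<open>On this compact square \<open>hcosh\<close> is uniformly continuous, and on
      its diagonal it equals 1. One mesh size therefore serves all steps of the partition.\<close>
    have "continuous_on ({0..1} \<times> {0..1}) (\<lambda>p. hcosh (g (fst p)) (g (snd p)))"
    proof (rule continuous_hcosh)
      show "continuous_on ({0..1} \<times> {0..1}) (\<lambda>p. g (fst p))"
        using g(1) unfolding path_def
        by (rule continuous_on_compose2) (auto intro!: continuous_intros)
      show "continuous_on ({0..1} \<times> {0..1}) (\<lambda>p. g (snd p))"
        using g(1) unfolding path_def
        by (rule continuous_on_compose2) (auto intro!: continuous_intros)
    qed (use in_ball in auto)
    then have "uniformly_continuous_on ({0..1} \<times> {0..1}) (\<lambda>p. hcosh (g (fst p)) (g (snd p)))"
      by (intro compact_uniformly_continuous compact_Times) auto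
    then obtain d where d: "d > 0" and
      unif: "\<And>p q. p \<in> {0..1} \<times> {0..1} \<Longrightarrow> q \<in> {0..1} \<times> {0..1} \<Longrightarrow> dist q p < d \<Longrightarrow>
        dist (hcosh (g (fst q)) (g (snd q))) (hcosh (g (fst p)) (g (snd p))) < e"
      using e unfolding uniformly_continuous_on_def by metis
    obtain n where n: "1 / real (Suc n) < d"
      using d by (metis nat_approx_posE)
    define N where "N = Suc n"
    define t where "t i = real i / real N" for i
    have t01: "t i \<in> {0..1}" if "i \<le> N" for i
      using that by (auto simp: t_def N_def)
    have small: "hcosh (g (t i)) (g (t (Suc i))) \<le> 1 + e" if "i < N" for i
    proof -
      have "dist (t i, t (Suc i)) (t i, t i) = 1 / real N"
        by (simp add: dist_Pair_Pair dist_real_def t_def diff_divide_distrib[symmetric])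
      then have "dist (hcosh (g (t i)) (g (t (Suc i)))) (hcosh (g (t i)) (g (t i))) < e"
        using unif[of "(t i, t i)" "(t i, t (Suc i))"] t01[of i] t01[of "Suc i"] that n
        by (simp add: N_def)
      then show ?thesis
        using hcosh_self[OF in_ball[OF t01[of i]]] that by (simp add: dist_real_def)
    qed
    have "hdist (g 0) (g 1) = hdist (g (t 0)) (g (t N))"
      by (simp add: t_def N_def)
    also have "\<dots> \<le> (\<Sum>i<N. hdist (g (t i)) (g (t (Suc i))))"
      by (rule hdist_polygon) (intro in_ball t01)
    also have "\<dots> \<le> (\<Sum>i<N. (1 + e) * rho (g (t i)) (g (t (Suc i))))"
      by (intro sum_mono hdist_le_rho in_ball t01 small) auto
    also have "\<dots> = (1 + e) * (\<Sum>i<N. rho (g (t i)) (g (t (Suc i))))"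
      by (simp add: sum_distrib_left)
    finally have le: "hdist (g 0) (g 1) / (1 + e) \<le> (\<Sum>i<N. rho (g (t i)) (g (t (Suc i))))"
      using e by (simp add: field_simps)
    \<comment> \<open>The list has N + 1 nodes, so its polygonal sum has N terms.\<close>
    define ts where "ts = map t [0..<Suc N]"
    have len: "length ts - 1 = N"
      by (simp add: ts_def)
    have nth: "ts ! i = t i" if "i \<le> N" for i
      using that by (simp add: ts_def nth_append)
    have "sorted ts"
      by (auto simp: sorted_iff_nth_mono ts_def t_def nth_append divide_right_mono simp del: upt_Suc)
    moreover have "set ts \<subseteq> {0..1}"
      unfolding ts_def using t01 by (auto simp del: upt_Suc)
    ultimately have "ereal (\<Sum>i<length ts - 1. rho (g (ts ! i)) (g (ts ! Suc i))) \<le> rho_length g"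
      unfolding rho_length_def by (intro SUP_upper) simp
    then have "ereal (\<Sum>i<N. rho (g (t i)) (g (t (Suc i)))) \<le> rho_length g"
      by (simp add: len nth Suc_leI less_imp_le del: One_nat_def cong: sum.cong_simp)
    with le show ?thesis
      by (meson ereal_less_eq(3) order_trans)
  qed
  \<comment> \<open>Let e run through 1 / (n + 1).\<close>
  have "(\<lambda>n. ereal (hdist (g 0) (g 1) / (1 + 1 / real (Suc n)))) \<longlonglongrightarrow> ereal (hdist (g 0) (g 1) / (1 + 0))"
    by (intro tendsto_ereal tendsto_divide tendsto_add tendsto_const
      LIMSEQ_inverse_real_of_nat[unfolded inverse_eq_divide]) simp
  then have "ereal (hdist (g 0) (g 1) / (1 + 0)) \<le> rho_length g"
    by (rule LIMSEQ_le_const2) (intro exI allI impI key, simp)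
  then show ?thesis by simp
qed

text \<open>Upper bound: on the constant speed path each step has \<open>rho\<close> = tanh d <= d,
  and the steps in \<open>hdist\<close> add up to at most \<open>hdist z w\<close>. Lower bound:
  \<open>hdist_le_rho_length\<close> for every path.\<close>

lemma bergman_dist_eq_hdist:
  fixes z w :: "complex ^ 'n"
  assumes z: "z \<in> ball 0 1" and w: "w \<in> ball 0 1"
  shows "bergman_dist z w = ereal (hdist z w)"
proof (rule antisym)
  obtain g where g: "path g" "path_image g \<subseteq> ball 0 1" "pathstart g = z" "pathfinish g = w"
    and speed: "\<And>s t. hdist (g s) (g t) = \<bar>s - t\<bar> * hdist z w"
    using constant_speed_path[OF z w] by metis
  have "rho_length g \<le> ereal (hdist z w)"
    unfolding rho_length_def
  proof (intro SUP_least, clarify)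
    fix ts :: "real list"
    assume ts: "sorted ts" "set ts \<subseteq> {0..1}"
    have in_ball: "g (ts ! i) \<in> ball 0 1" if "i < length ts" for i
      using g(2) ts(2) nth_mem[OF that] unfolding path_image_def by blast
    have "rho (g (ts ! i)) (g (ts ! Suc i)) \<le> \<bar>ts ! i - ts ! Suc i\<bar> * hdist z w"
      if "i < length ts - 1" for i
    proof -
      have "rho (g (ts ! i)) (g (ts ! Suc i)) \<le> hdist (g (ts ! i)) (g (ts ! Suc i))"
        using in_ball that by (subst rho_tanh) (auto intro!: tanh_real_le_self hdist_nonneg)
      then show ?thesis by (simp add: speed)
    qed
    then have "(\<Sum>i<length ts - 1. rho (g (ts ! i)) (g (ts ! Suc i)))
        \<le> (\<Sum>i<length ts - 1. \<bar>ts ! i - ts ! Suc i\<bar>) * hdist z w"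
      unfolding sum_distrib_right by (intro sum_mono) auto
    also have "\<dots> \<le> 1 * hdist z w"
      by (intro mult_right_mono sum_sorted_steps_le ts hdist_nonneg z w)
    finally show "ereal (\<Sum>i<length ts - 1. rho (g (ts ! i)) (g (ts ! Suc i))) \<le> ereal (hdist z w)"
      by simp
  qed
  then show "bergman_dist z w \<le> ereal (hdist z w)"
    unfolding bergman_dist_def using g by (intro INF_lower2[of g]) auto
  show "ereal (hdist z w) \<le> bergman_dist z w"
    unfolding bergman_dist_def
    by (intro INF_greatest) (auto simp: pathstart_def pathfinish_def dest: hdist_le_rho_length)
qed

section \<open>Triples of points\<close>

lemma is_geodesic_hline:
  assumes "lform P P = 1" "lform P V = 0" "lform V V = -1"
  shows "is_geodesic (range (hline P V))"
  unfolding is_geodesic_def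
proof (intro exI conjI allI)
  show "range (hline P V) \<subseteq> ball 0 1"
    using hline_in_ball[OF assms] by blast
  show "bergman_dist (hline P V s) (hline P V t) = ereal \<bar>s - t\<bar>" for s t
    using bergman_dist_eq_hdist[OF hline_in_ball[OF assms] hline_in_ball[OF assms]]
    by (simp add: hdist_hline[OF assms])
qed simp

text \<open>This is the vanishing of the Gram determinant of three vectors on one hyperbola, which
  span only a plane; the arguments are their parameter differences.\<close>

lemma cosh_sum_identity:
  fixes x y z :: real
  assumes "x + y + z = 0"
  shows "(cosh x)\<^sup>2 + (cosh y)\<^sup>2 + (cosh z)\<^sup>2 = 1 + 2 * (cosh x * cosh y * cosh z)"
proof -
  have z: "cosh z = cosh x * cosh y + sinh x * sinh y"
    using assms by (metis add_eq_0_iff2 cosh_add cosh_minus)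
  show ?thesis
    unfolding z using cosh_square_eq[of x] cosh_square_eq[of y] by algebra
qed

lemma complex_eq_cmod:
  assumes "cmod z \<le> Re z"
  shows "z = of_real (cmod z)"
proof -
  have Re: "Re z = cmod z"
    using assms complex_Re_le_cmod[of z] by simp
  then have "Im z = 0"
    using cmod_power2[of z] by simp
  with Re show ?thesis
    by (simp add: complex_eq_iff)
qed

text \<open>Multiplying each of the three unit vectors by a phase leaves this product unchanged, so
  it is an invariant of the points.\<close>

definition gram_triple :: "complex ^ 'n \<Rightarrow> complex ^ 'n \<Rightarrow> complex ^ 'n \<Rightarrow> complex" where
  "gram_triple x y z = lform (lift x) (lift y) * lform (lift y) (lift z) * lform (lift z) (lift x)"

lemma cmod_gram_triple: "cmod (gram_triple x y z) = hcosh x y * hcosh y z * hcosh z x"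
  by (simp add: gram_triple_def hcosh_def norm_mult)

text \<open>Being a geodesic is a metric condition and yields only the moduli of the products; the
  phase of the triple product comes from the Gram inequality.\<close>

lemma geodesic_imp_gram:
  assumes L: "is_geodesic L" "{x, y, z} \<subseteq> L"
  shows "(hcosh x y)\<^sup>2 + (hcosh y z)\<^sup>2 + (hcosh z x)\<^sup>2 = 1 + 2 * (hcosh x y * hcosh y z * hcosh z x)"
    and "gram_triple x y z = of_real (hcosh x y * hcosh y z * hcosh z x)"
proof -
  obtain c :: "real \<Rightarrow> complex ^ 'a" where c: "range c \<subseteq> ball 0 1" "L = range c"
    and iso: "\<And>s t. bergman_dist (c s) (c t) = ereal \<bar>s - t\<bar>"
    using L(1) unfolding is_geodesic_def by blast
  have in_ball: "c s \<in> ball 0 1" for s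
    using c(1) by blast
  have cosh: "hcosh (c s) (c t) = cosh (s - t)" for s t
  proof -
    have "hdist (c s) (c t) = \<bar>s - t\<bar>"
      using iso[of s t] bergman_dist_eq_hdist[OF in_ball in_ball, of s t] by simp
    then show ?thesis
      using cosh_hdist[OF in_ball in_ball, of s t] by simp
  qed
  obtain r s t where xyz: "x = c r" "y = c s" "z = c t"
    using L(2) c(2) by auto
  show eq: "(hcosh x y)\<^sup>2 + (hcosh y z)\<^sup>2 + (hcosh z x)\<^sup>2 = 1 + 2 * (hcosh x y * hcosh y z * hcosh z x)"
    unfolding xyz cosh by (rule cosh_sum_identity) simp
  have "(hcosh x y)\<^sup>2 + (hcosh y z)\<^sup>2 + (hcosh z x)\<^sup>2 \<le> 1 + 2 * Re (gram_triple x y z)"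
    unfolding hcosh_def gram_triple_def xyz
    by (intro gram_det_nonneg lform_lift_self in_ball)
  \<comment> \<open>Subtracting the identity for the moduli from the Gram inequality leaves exactly
    this.\<close>
  then have "cmod (gram_triple x y z) \<le> Re (gram_triple x y z)"
    unfolding cmod_gram_triple using eq by linarith
  then show "gram_triple x y z = of_real (hcosh x y * hcosh y z * hcosh z x)"
    using complex_eq_cmod cmod_gram_triple by metis
qed

text \<open>The line is laid through x and y. The vector \<open>G\<close> on it at the signed
  distance of z from x is then shown to equal the normalised lift \<open>R\<close> of z.\<close>

lemma gram_imp_geodesic:
  assumes x: "x \<in> ball 0 1" and y: "y \<in> ball 0 1" and z: "z \<in> ball 0 1" and neq: "x \<noteq> y"
    and det: "(hcosh x y)\<^sup>2 + (hcosh y z)\<^sup>2 + (hcosh z x)\<^sup>2 = 1 + 2 * (hcosh x y * hcosh y z * hcosh z x)"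
    and pos: "gram_triple x y z = of_real (hcosh x y * hcosh y z * hcosh z x)"
  shows "\<exists>L. is_geodesic L \<and> {x, y, z} \<subseteq> L"
proof -
  define P where "P = lift x"
  have PP: "lform P P = 1"
    unfolding P_def by (rule lform_lift_self[OF x])
  obtain u where u: "cmod u = 1" and uP: "lform (cscale u (lift y)) P = of_real (hcosh x y)"
    and uu: "lform (cscale u (lift y)) (cscale u (lift y)) = 1" and yu: "proj (cscale u (lift y)) = y"
    using phase_normalise[OF lform_lift_self[OF y], of P] proj_lift[OF y]
    unfolding P_def hcosh_commute[of x y] hcosh_def[of y x] by metis
  obtain v where v: "cmod v = 1" and vP: "lform (cscale v (lift z)) P = of_real (hcosh z x)"
    and vv: "lform (cscale v (lift z)) (cscale v (lift z)) = 1" and zv: "proj (cscale v (lift z)) = z"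
    using phase_normalise[OF lform_lift_self[OF z], of P] proj_lift[OF z]
    unfolding P_def hcosh_def[of z x] by metis
  define Q where "Q = cscale u (lift y)"
  define R where "R = cscale v (lift z)"
  define \<alpha> where "\<alpha> = hdist x y"
  have \<alpha>: "hcosh x y = cosh \<alpha>"
    by (simp add: \<alpha>_def cosh_hdist[OF x y])
  have \<beta>: "hcosh z x = cosh (hdist z x)"
    by (simp add: cosh_hdist[OF z x])
  have \<alpha>0: "\<alpha> \<noteq> 0"
    using hcosh_eq_1[OF x y] neq \<alpha> by auto
  have PQ: "lform P Q = of_real (cosh \<alpha>)"
    using uP \<alpha> by (metis Q_def lform_cnj complex_cnj_complex_of_real)
  have phase: "cnj u * u = 1" "v * cnj v = 1"
    using of_real_cmod_square[of u] of_real_cmod_square[of v] u v by (simp_all add: mult.commute)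
  have "lform P Q * lform Q R * lform R P = (cnj u * u) * (v * cnj v) * gram_triple x y z"
    by (simp add: P_def Q_def R_def lform_simps gram_triple_def)
  \<comment> \<open>Two products are positive by the choice of phases, and the triple product does
    not depend on that choice; so the third product is positive too.\<close>
  then have "of_real (hcosh x y) * lform Q R * of_real (hcosh z x)
      = of_real (hcosh x y) * of_real (hcosh y z) * complex_of_real (hcosh z x)"
    unfolding phase pos using PQ \<alpha> vP by (simp add: R_def)
  then have QR: "lform Q R = of_real (hcosh y z)"
    by (simp add: \<alpha> \<beta>)
  then have RQ: "lform R Q = of_real (hcosh y z)"
    by (metis lform_cnj complex_cnj_complex_of_real)
  \<comment> \<open>The vanishing determinant, with the square completed in
    \<open>hcosh y z\<close>.\<close>
  have "(hcosh y z - cosh \<alpha> * cosh (hdist z x))\<^sup>2 = (sinh \<alpha> * sinh (hdist z x))\<^sup>2"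
    using det cosh_square_eq[of \<alpha>] cosh_square_eq[of "hdist z x"] unfolding \<alpha> \<beta> by algebra
  then have "hcosh y z = cosh (\<alpha> - hdist z x) \<or> hcosh y z = cosh (\<alpha> - (- hdist z x))"
    unfolding power2_eq_iff cosh_diff cosh_minus sinh_minus by auto
  \<comment> \<open>\<open>t\<close> is plus or minus the distance from x to z, the sign telling on
    which side of x the point z should lie.\<close>
  then obtain t where t: "hcosh y z = cosh (\<alpha> - t)" "hcosh z x = cosh t"
    using \<beta> by (metis cosh_minus)
  define V where "V = cscale (of_real (1 / sinh \<alpha>)) (Q - cscale (of_real (cosh \<alpha>)) P)"
  have QQ: "lform Q Q = 1" and QP: "lform Q P = of_real (cosh \<alpha>)" and RR: "lform R R = 1"
    and RP: "lform R P = of_real (cosh t)"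
    using uu uP vv vP \<alpha> t by (simp_all add: Q_def R_def)
  note through = hline_through[OF PP QQ QP \<alpha>0, folded V_def]
  have RV: "lform R V = - of_real (sinh t)"
  proof -
    have "lform R V = of_real ((1 / sinh \<alpha>) * (cosh (\<alpha> - t) - cosh \<alpha> * cosh t))"
      by (simp add: V_def lform_simps RQ RP t)
    also have "(1 / sinh \<alpha>) * (cosh (\<alpha> - t) - cosh \<alpha> * cosh t) = - sinh t"
      using \<alpha>0 by (simp add: cosh_diff)
    finally show ?thesis by simp
  qed
  define G where "G = cscale (of_real (cosh t)) P + cscale (of_real (sinh t)) V"
  have GG: "lform G G = 1"
    unfolding G_def using lform_hline[OF PP through(1,2), of t t] by simp
  have "lform R G = of_real ((cosh t)\<^sup>2 - (sinh t)\<^sup>2)"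
    by (simp add: G_def lform_simps RP RV power2_eq_square)
  then have RG: "lform R G = 1"
    by (simp add: cosh_square_eq)
  then have GR: "lform G R = 1"
    by (metis lform_cnj complex_cnj_one)
  have PR: "lform P R = of_real (cosh t)"
    using RP by (metis lform_cnj complex_cnj_complex_of_real)
  \<comment> \<open>\<open>R - G\<close> is null and orthogonal to \<open>P\<close>, hence zero by
    definiteness.\<close>
  have "lform (R - G) (R - G) = 0"
    by (simp add: lform_simps RR RG GR GG)
  moreover have "lform P (R - G) = 0"
    by (simp add: G_def lform_simps PR PP through(1))
  ultimately have "R - G = 0"
    using lform_orthogonal_neg(2)[of P "R - G"] PP by simp
  then have "hline P V t = z"
    using zv by (simp add: hline_def G_def R_def)
  moreover have "hline P V 0 = x" "hline P V \<alpha> = y"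
    using through(3,4) yu by (simp_all add: P_def Q_def proj_lift[OF x])
  ultimately have "{x, y, z} \<subseteq> range (hline P V)"
    by blast
  then show ?thesis
    using is_geodesic_hline[OF PP through(1,2)] by blast
qed

section \<open>The kernel invariants in terms of the form\<close>

text \<open>The reproducing property evaluates the kernel at x in the point y, whence the reversed
  order in \<open>hprod\<close>. The three invariants depend only on these products, so the context
  below keeps just this formula.\<close>

lemma (in drury_arveson) ip_kernel:
  assumes "x \<in> ball 0 1" "y \<in> ball 0 1"
  shows "ip (da_kernel x) (da_kernel y) = inverse (1 - hprod y x)"
  using reproducing[OF assms(2) kernel_mem[OF assms(1)]] assms(2)
  by (simp add: da_kernel_def)

context
  fixes ip :: "'v \<Rightarrow> 'v \<Rightarrow> complex" and k :: "complex ^ 'n \<Rightarrow> 'v"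
    and X :: "(complex ^ 'n) set"
  assumes ball: "X \<subseteq> ball 0 1"
    and ip: "\<And>x y. x \<in> X \<Longrightarrow> y \<in> X \<Longrightarrow> ip (k x) (k y) = inverse (1 - hprod y x)"
begin

lemma lform_lift_nonzero:
  assumes "x \<in> X" "y \<in> X"
  shows "lform (lift x) (lift y) \<noteq> 0"
proof -
  have "1 \<le> hcosh x y"
    using assms ball by (intro hcosh_ge_1) auto
  then show ?thesis
    by (auto simp: hcosh_def)
qed

text \<open>Passing from kernels to unit vectors of the form only introduces positive factors,
  one for each point, which cancel in all three invariants.\<close>

lemma ip_lform:
  obtains h :: "complex ^ 'n \<Rightarrow> real" where "\<And>x. x \<in> X \<Longrightarrow> 0 < h x"
    and "\<And>x y. x \<in> X \<Longrightarrow> y \<in> X \<Longrightarrow> ip (k x) (k y) = of_real (h x * h y) / lform (lift y) (lift x)"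
proof (rule that[of "\<lambda>x. 1 / sqrt (1 - (norm x)\<^sup>2)"])
  have pos: "0 < 1 / sqrt (1 - (norm x)\<^sup>2)" if "x \<in> X" for x
    using ball that ball_iff[of x] by (auto simp del: mem_ball_0)
  then show "0 < 1 / sqrt (1 - (norm x)\<^sup>2)" if "x \<in> X" for x
    using that .
  fix x y
  assume xy: "x \<in> X" "y \<in> X"
  define r where "r = 1 / sqrt (1 - (norm x)\<^sup>2) * (1 / sqrt (1 - (norm y)\<^sup>2))"
  have "r \<noteq> 0"
    using pos[OF xy(1)] pos[OF xy(2)] unfolding r_def by (metis less_irrefl mult_eq_0_iff)
  moreover have "lform (lift y) (lift x) = (1 - hprod y x) * of_real r"
    by (simp only: lform_lift r_def mult_ac)
  ultimately show "ip (k x) (k y) = of_real r / lform (lift y) (lift x)"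
    by (simp add: ip xy divide_inverse)
qed

text \<open>The factors \<open>h\<close> cancel, and what remains is the expression for
  \<open>rho\<close> in \<open>rho_hcosh\<close>.\<close>

lemma delta_hcosh:
  assumes x: "x \<in> X" and y: "y \<in> X"
  shows "delta ip (k x) (k y) = sqrt (1 - 1 / (hcosh x y)\<^sup>2)"
proof -
  obtain h :: "complex ^ 'n \<Rightarrow> real" where h: "\<And>x. x \<in> X \<Longrightarrow> 0 < h x"
    and k: "\<And>x y. x \<in> X \<Longrightarrow> y \<in> X \<Longrightarrow> ip (k x) (k y) = of_real (h x * h y) / lform (lift y) (lift x)"
    using ip_lform by blast
  have self: "ip (k z) (k z) = of_real (h z * h z)" if "z \<in> X" for z
    using that ball by (simp add: k lform_lift_self subset_eq)
  show ?thesis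
    using h[OF x] h[OF y] lform_lift_nonzero[OF x y] unfolding delta_def self[OF x] self[OF y]
    by (simp add: k x y hcosh_def cmod_lform_swap[of "lift y" "lift x"] norm_divide norm_mult
        power_divide power_mult_distrib power2_eq_square)
qed

text \<open>The product of the kernels is a positive multiple of 1 / \<open>cnj T\<close>, hence of
  \<open>T\<close>, so both have the same argument.\<close>

lemma angular_invariant_eq_0_iff:
  assumes x: "x \<in> X" and y: "y \<in> X" and z: "z \<in> X"
  shows "angular_invariant ip (k x) (k y) (k z) = 0 \<longleftrightarrow>
    gram_triple x y z = of_real (hcosh x y * hcosh y z * hcosh z x)"
proof -
  obtain h :: "complex ^ 'n \<Rightarrow> real" where h: "\<And>x. x \<in> X \<Longrightarrow> 0 < h x"
    and k: "\<And>x y. x \<in> X \<Longrightarrow> y \<in> X \<Longrightarrow> ip (k x) (k y) = of_real (h x * h y) / lform (lift y) (lift x)"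
    using ip_lform by blast
  define T where "T = gram_triple x y z"
  define r where "r = (h x * h y * h z)\<^sup>2 / (cmod T)\<^sup>2"
  have T0: "T \<noteq> 0"
    using assms lform_lift_nonzero by (simp add: T_def gram_triple_def)
  have r: "r > 0"
    using h[OF x] h[OF y] h[OF z] T0 by (simp add: r_def)
  have "ip (k x) (k y) * ip (k y) (k z) * ip (k z) (k x) = of_real ((h x * h y * h z)\<^sup>2) / cnj T"
    by (simp add: k assms T_def gram_triple_def lform_cnj power2_eq_square)
  also have "\<dots> = of_real r * T"
    using T0 by (simp add: r_def of_real_cmod_square)
  finally have "angular_invariant ip (k x) (k y) (k z) = Arg T"
    unfolding angular_invariant_def using r by simp
  moreover have "Arg T = 0 \<longleftrightarrow> T = of_real (cmod T)"
    by (metis Arg_eq_0 Arg_of_real Re_complex_of_real Reals_of_real complex_is_Real_iff norm_ge_zero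
        of_real_Re cmod_eq_Re abs_of_nonneg)
  ultimately show ?thesis
    by (simp add: T_def cmod_gram_triple)
qed

text \<open>After clearing denominators the left side is |a c - cnj b|^2 = (|a|^2 - 1)(|c|^2 - 1),
  the equality case of the Cauchy-Schwarz estimate in \<open>gram_det_nonneg\<close>. Distinctness
  of x and y gives |a| > 1, so the division by \<open>delta\<close> is legitimate.\<close>

lemma LF_eq_delta_iff:
  assumes x: "x \<in> X" and y: "y \<in> X" and z: "z \<in> X" and neq: "x \<noteq> y"
  shows "LF ip (k x) (k y) (k z) = delta ip (k x) (k z) \<longleftrightarrow>
    (hcosh x y)\<^sup>2 + (hcosh y z)\<^sup>2 + (hcosh z x)\<^sup>2 = 1 + 2 * Re (gram_triple x y z)"
proof -
  obtain h :: "complex ^ 'n \<Rightarrow> real" where h: "\<And>x. x \<in> X \<Longrightarrow> 0 < h x"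
    and k: "\<And>x y. x \<in> X \<Longrightarrow> y \<in> X \<Longrightarrow> ip (k x) (k y) = of_real (h x * h y) / lform (lift y) (lift x)"
    using ip_lform by blast
  define a b c where "a = lform (lift x) (lift y)" and "b = lform (lift y) (lift z)"
    and "c = lform (lift z) (lift x)"
  have nz: "a \<noteq> 0" "b \<noteq> 0" "c \<noteq> 0"
    using assms lform_lift_nonzero by (simp_all add: a_def b_def c_def)
  have b': "lform (lift z) (lift y) = cnj b"
    by (simp add: b_def lform_cnj)
  have cosh: "hcosh x y = cmod a" "hcosh y z = cmod b" "hcosh z x = cmod c"
    by (simp_all add: hcosh_def a_def b_def c_def)
  have xx: "lform (lift x) (lift x) = 1"
    using x ball by (intro lform_lift_self) auto
  have quot: "ip (k y) (k x) * ip (k x) (k z) / (ip (k y) (k z) * ip (k x) (k x)) = cnj b / (a * c)"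
    using h[OF x] h[OF y] h[OF z] nz
    by (simp add: k assms xx b' a_def[symmetric] c_def[symmetric] field_simps)
  have "1 \<le> cmod a" "cmod a \<noteq> 1"
    using hcosh_ge_1[of x y] hcosh_eq_1[of x y] neq subsetD[OF ball x] subsetD[OF ball y]
    unfolding cosh by blast+
  then have a1: "(cmod a)\<^sup>2 > 1"
    by (simp add: one_less_power)
  have "(cmod (1 - cnj b / (a * c)))\<^sup>2 = (cmod ((a * c - cnj b) / (a * c)))\<^sup>2"
    using nz by (simp add: diff_divide_distrib)
  also have "\<dots> = (cmod (a * c - cnj b))\<^sup>2 / ((cmod a)\<^sup>2 * (cmod c)\<^sup>2)"
    by (simp add: norm_divide norm_mult power_divide power_mult_distrib)
  finally have sq: "(cmod (1 - cnj b / (a * c)))\<^sup>2 = (cmod (a * c - cnj b))\<^sup>2 / ((cmod a)\<^sup>2 * (cmod c)\<^sup>2)" .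
  have "(delta ip (k x) (k y))\<^sup>2 = 1 - 1 / (cmod a)\<^sup>2"
    using a1 by (simp add: delta_hcosh x y cosh divide_le_eq_1)
  then have "LF ip (k x) (k y) (k z)
      = sqrt (1 / (1 - 1 / (cmod a)\<^sup>2) * ((cmod (a * c - cnj b))\<^sup>2 / ((cmod a)\<^sup>2 * (cmod c)\<^sup>2)))"
    unfolding LF_def quot sq by simp
  moreover have "delta ip (k x) (k z) = sqrt (1 - 1 / (cmod c)\<^sup>2)"
    by (simp add: delta_hcosh x z cosh hcosh_commute[of x z])
  ultimately have "LF ip (k x) (k y) (k z) = delta ip (k x) (k z) \<longleftrightarrow>
      1 / (1 - 1 / (cmod a)\<^sup>2) * ((cmod (a * c - cnj b))\<^sup>2 / ((cmod a)\<^sup>2 * (cmod c)\<^sup>2)) = 1 - 1 / (cmod c)\<^sup>2"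
    by simp
  also have "\<dots> \<longleftrightarrow> (cmod (a * c - cnj b))\<^sup>2 = ((cmod a)\<^sup>2 - 1) * ((cmod c)\<^sup>2 - 1)"
  proof -
    \<comment> \<open>Here \<open>A\<close>, \<open>C\<close>, \<open>S\<close> stand for |a|^2,
      |c|^2 and |a c - cnj b|^2; both sides get the common denominator (A - 1) C.\<close>
    have *: "1 / (1 - 1 / A) * (S / (A * C)) = 1 - 1 / C \<longleftrightarrow> S = (A - 1) * (C - 1)"
      if "A > 1" "C > 0" for A C S :: real
    proof -
      have "1 / (1 - 1 / A) * (S / (A * C)) = S / ((A - 1) * C)"
        using that by (simp add: field_simps)
      moreover have "1 - 1 / C = ((A - 1) * (C - 1)) / ((A - 1) * C)"
        using that by (simp add: field_simps)
      ultimately show ?thesis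
        using that by (simp only: divide_cancel_right) simp
    qed
    show ?thesis
      using a1 nz by (intro *) auto
  qed
  also have "(cmod (a * c - cnj b))\<^sup>2 = (cmod a)\<^sup>2 * (cmod c)\<^sup>2 + (cmod b)\<^sup>2 - 2 * Re (a * b * c)"
    unfolding cmod_power2 by (simp add: power2_eq_square algebra_simps)
  finally show ?thesis
    unfolding cosh gram_triple_def a_def[symmetric] b_def[symmetric] c_def[symmetric]
    by (simp add: algebra_simps)
qed

end

lemma da_kernel_in_span: "x \<in> X \<Longrightarrow> da_kernel x \<in> da_span X"
  unfolding da_span_def by (intro CollectI exI[of _ "{x}"] exI[of _ "\<lambda>_. 1"]) auto

theorem proposition24:
  fixes X :: "(complex ^ 'n) set"
    and x\<^sub>1 x\<^sub>2 x\<^sub>3 :: "complex ^ 'n"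
    and DA H :: "(complex ^ 'n \<Rightarrow> complex) set"
    and ip ipH :: "(complex ^ 'n \<Rightarrow> complex) \<Rightarrow> (complex ^ 'n \<Rightarrow> complex) \<Rightarrow> complex"
    and k :: "complex ^ 'n \<Rightarrow> complex ^ 'n \<Rightarrow> complex"
  assumes "X = {x\<^sub>1, x\<^sub>2, x\<^sub>3}" and "card X = 3" and "X \<subseteq> ball 0 1"
    and "drury_arveson DA ip"
    and "H = da_span X" and "\<And>f g. f \<in> H \<Longrightarrow> g \<in> H \<Longrightarrow> ipH f g = ip f g"
    and "k = da_kernel"
  shows "(\<exists>L. is_geodesic L \<and> X \<subseteq> L) \<longleftrightarrow>
         LF ipH (k x\<^sub>1) (k x\<^sub>2) (k x\<^sub>3) = delta ipH (k x\<^sub>1) (k x\<^sub>3) \<and>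
         angular_invariant ipH (k x\<^sub>1) (k x\<^sub>2) (k x\<^sub>3) = 0"
proof -
  interpret drury_arveson DA ip by fact
  have ker: "ipH (k x) (k y) = inverse (1 - hprod y x)" if "x \<in> X" "y \<in> X" for x y
  proof -
    have "ipH (k x) (k y) = ip (da_kernel x) (da_kernel y)"
      unfolding assms(7) using that by (intro assms(6)) (simp_all add: assms(5) da_kernel_in_span)
    also have "\<dots> = inverse (1 - hprod y x)"
      using that assms(3) by (intro ip_kernel) blast+
    finally show ?thesis .
  qed
  \<comment> \<open>This makes \<open>delta\<close> of the first two kernels nonzero and determines
    the line through the two points.\<close>
  have neq: "x\<^sub>1 \<noteq> x\<^sub>2"
    using assms(1,2) by (auto simp: card_insert_if split: if_splits)
  have mem: "x\<^sub>1 \<in> X" "x\<^sub>2 \<in> X" "x\<^sub>3 \<in> X"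
    using assms(1) by auto
  let ?det = "(hcosh x\<^sub>1 x\<^sub>2)\<^sup>2 + (hcosh x\<^sub>2 x\<^sub>3)\<^sup>2 + (hcosh x\<^sub>3 x\<^sub>1)\<^sup>2"
  let ?prod = "hcosh x\<^sub>1 x\<^sub>2 * hcosh x\<^sub>2 x\<^sub>3 * hcosh x\<^sub>3 x\<^sub>1"
  have "(\<exists>L. is_geodesic L \<and> X \<subseteq> L) \<longleftrightarrow>
      ?det = 1 + 2 * ?prod \<and> gram_triple x\<^sub>1 x\<^sub>2 x\<^sub>3 = of_real ?prod"
  proof
    assume "\<exists>L. is_geodesic L \<and> X \<subseteq> L"
    then obtain L where "is_geodesic L" "{x\<^sub>1, x\<^sub>2, x\<^sub>3} \<subseteq> L"
      unfolding assms(1) by blast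
    from geodesic_imp_gram[OF this]
    show "?det = 1 + 2 * ?prod \<and> gram_triple x\<^sub>1 x\<^sub>2 x\<^sub>3 = of_real ?prod"
      by (rule conjI)
  next
    assume "?det = 1 + 2 * ?prod \<and> gram_triple x\<^sub>1 x\<^sub>2 x\<^sub>3 = of_real ?prod"
    then show "\<exists>L. is_geodesic L \<and> X \<subseteq> L"
      unfolding assms(1) using mem[THEN subsetD[OF assms(3)]] neq
      by (intro gram_imp_geodesic) (erule conjE, assumption)+
  qed
  \<comment> \<open>Given the second conjunct, the product of the moduli is the real part of the
    triple product. This turns the first conjunct into the condition on \<open>LF\<close>.\<close>
  also have "\<dots> \<longleftrightarrow> ?det = 1 + 2 * Re (gram_triple x\<^sub>1 x\<^sub>2 x\<^sub>3) \<and> gram_triple x\<^sub>1 x\<^sub>2 x\<^sub>3 = of_real ?prod"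
    by (metis Re_complex_of_real)
  also have "\<dots> \<longleftrightarrow> LF ipH (k x\<^sub>1) (k x\<^sub>2) (k x\<^sub>3) = delta ipH (k x\<^sub>1) (k x\<^sub>3) \<and>
      angular_invariant ipH (k x\<^sub>1) (k x\<^sub>2) (k x\<^sub>3) = 0"
    by (simp only: LF_eq_delta_iff[where ip = ipH and k = k, OF assms(3) ker mem neq]
        angular_invariant_eq_0_iff[where ip = ipH and k = k, OF assms(3) ker mem])
  finally show ?thesis .
qed

end
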